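(* Let $R$ be a commutative ring with unit, let $\widehat{\mathcal A}$ be the pseudo Maurer-Cartan perturbation algebra over $R$ with its algebra differential $D$, let $\phi\colon \widehat{\mathcal A}\to\widehat{\mathcal A}$ be the involution of graded $R$-algebras determined by $\phi(x)=-x$, $\phi(s)=\alpha s=s\beta$, $\phi(t)=\alpha t\beta$, and let $D^\phi=\phi D\phi$. Then the algebra differential $D^\phi$ on $\widehat{\mathcal A}$ coincides with the twisted differential $D^x$, given by $D^x(a)=Da+[x,a]$ for $a\in\widehat{\mathcal A}$.
   Context: $R$ is a commutative ring with unit; algebras are $R$-algebras; differentials lower degree by $1$. The pseudocontraction algebra $\mathcal H$ is the differential graded algebra generated by $s$ (degree $1$) and $\tau$ (degree $0$), with differential $D$, subject to $Ds=\tau$ and $s^2=0$ (hence $D\tau=0$). $\mathcal P$ is the differential graded algebra having a single generator $x$ of degree $-1$, subject to $Dx+x^2=0$. The pseudo perturbation algebra is the free product (coproduct) of augmented differential graded algebras $\mathcal A=\mathcal P*\mathcal H$, with differential still denoted by $D$. Write $t=1-\tau$. The pseudo Maurer-Cartan perturbation algebra $\widehat{\mathcal A}$ is the graded $R$-algebra that arises from $\mathcal A$ by formally inverting the degree zero members $1+sx$ and $1+xs$; the differential $D$ extends to $\widehat{\mathcal A}$, and the extension is again denoted by $D$. Write $\alpha=(1+sx)^{-1}$ and $\beta=(1+xs)^{-1}$ in $\widehat{\mathcal A}_0$. $[\,\cdot\,,\,\cdot\,]$ denotes the graded commutator, $[x,a]=xa-(-1)^{|a|}ax$ for homogeneous $a$.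 *)

theory Defs
  imports Main
begin

section \<open>Algebras presented by generators and relations\<close>

datatype ('r, 'g) alg_term =
    Const 'r
  | Gen 'g
  | Add "('r, 'g) alg_term" "('r, 'g) alg_term"
  | Mul "('r, 'g) alg_term" "('r, 'g) alg_term"

text \<open>
  Terms modulo \<open>alg_cong E\<close> form the associative unital \<open>'r\<close>-algebra on the generators \<open>'g\<close>
  subject to the relations \<open>l = r\<close> for \<open>(l, r) \<in> E\<close>; for empty \<open>E\<close> it is the free algebra.
  The ground ring enters through the central constants \<open>Const r\<close>.
\<close>

inductive alg_cong :: "(('r::comm_ring_1, 'g) alg_term \<times> ('r, 'g) alg_term) set
    \<Rightarrow> ('r, 'g) alg_term \<Rightarrow> ('r, 'g) alg_term \<Rightarrow> bool"
  for E where
  rel: "(a, b) \<in> E \<Longrightarrow> alg_cong E a b"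
| refl: "alg_cong E a a"
| sym: "alg_cong E a b \<Longrightarrow> alg_cong E b a"
| trans: "alg_cong E a b \<Longrightarrow> alg_cong E b c \<Longrightarrow> alg_cong E a c"
| add_cong: "alg_cong E a a' \<Longrightarrow> alg_cong E b b' \<Longrightarrow> alg_cong E (Add a b) (Add a' b')"
| mul_cong: "alg_cong E a a' \<Longrightarrow> alg_cong E b b' \<Longrightarrow> alg_cong E (Mul a b) (Mul a' b')"
| add_assoc: "alg_cong E (Add (Add a b) c) (Add a (Add b c))"
| add_comm: "alg_cong E (Add a b) (Add b a)"
| add_zero: "alg_cong E (Add (Const 0) a) a"
| add_neg: "alg_cong E (Add (Mul (Const (- 1)) a) a) (Const 0)"
| mul_assoc: "alg_cong E (Mul (Mul a b) c) (Mul a (Mul b c))"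
| one_mul: "alg_cong E (Mul (Const 1) a) a"
| mul_one: "alg_cong E (Mul a (Const 1)) a"
| distr_right: "alg_cong E (Mul (Add a b) c) (Add (Mul a c) (Mul b c))"
| distr_left: "alg_cong E (Mul a (Add b c)) (Add (Mul a b) (Mul a c))"
| const_add: "alg_cong E (Const (p + q)) (Add (Const p) (Const q))"
| const_mul: "alg_cong E (Const (p * q)) (Mul (Const p) (Const q))"
| const_central: "alg_cong E (Mul (Const p) a) (Mul a (Const p))"

primrec eval :: "('r \<Rightarrow> 'b::ring_1) \<Rightarrow> ('g \<Rightarrow> 'b) \<Rightarrow> ('r, 'g) alg_term \<Rightarrow> 'b" where
  "eval \<rho> f (Const r) = \<rho> r"
| "eval \<rho> f (Gen g) = f g"
| "eval \<rho> f (Add a b) = eval \<rho> f a + eval \<rho> f b"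
| "eval \<rho> f (Mul a b) = eval \<rho> f a * eval \<rho> f b"

lemma eval_cong:
  fixes \<rho> :: "'r::comm_ring_1 \<Rightarrow> 'b::ring_1"
  assumes "\<And>p q. \<rho> (p + q) = \<rho> p + \<rho> q" "\<And>p q. \<rho> (p * q) = \<rho> p * \<rho> q" "\<rho> 1 = 1"
    and "\<And>p b. \<rho> p * b = b * \<rho> p"
    and "\<And>l r. (l, r) \<in> E \<Longrightarrow> eval \<rho> f l = eval \<rho> f r"
    and "alg_cong E a b"
  shows "eval \<rho> f a = eval \<rho> f b"
proof -
  have z: "\<rho> 0 = 0" using assms(1)[of 0 0] by simp
  have n: "\<rho> (- 1) = - 1"
    using assms(1)[of "-1" 1] z assms(3) by (simp add: eq_neg_iff_add_eq_0)
  from assms(6) show ?thesis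
    proof induction
    case (const_central p a)
    show ?case by (simp add: assms(4))
  qed (simp_all add: assms(1-3,5) z n algebra_simps)
qed


section \<open>The pseudo Maurer-Cartan perturbation algebra\<close>

datatype gen = X | S | Tau | Alpha | Beta

fun gen_deg :: "gen \<Rightarrow> int" where
  "gen_deg X = - 1"
| "gen_deg S = 1"
| "gen_deg Tau = 0"
| "gen_deg Alpha = 0"
| "gen_deg Beta = 0"

type_synonym 'r trm = "('r, gen) alg_term"

text \<open>The automorphism acting on degree \<open>n\<close> as multiplication by \<open>(- 1)\<^sup>n\<close>.\<close>

primrec sign_trm :: "'r::comm_ring_1 trm \<Rightarrow> 'r trm" where
  "sign_trm (Const r) = Const r"
| "sign_trm (Gen g) = (if even (gen_deg g) then Gen g else Mul (Const (- 1)) (Gen g))"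
| "sign_trm (Add a b) = Add (sign_trm a) (sign_trm b)"
| "sign_trm (Mul a b) = Mul (sign_trm a) (sign_trm b)"

text \<open>
  \<open>Dx = - x\<^sup>2\<close>, \<open>Ds = \<tau>\<close>, \<open>D\<tau> = 0\<close>; the Leibniz rule then gives
  \<open>D(1 + sx) = \<tau>x + sx\<^sup>2\<close> and \<open>D(1 + xs) = - (x\<^sup>2s + x\<tau>)\<close>, and the values on the
  formal inverses are forced: \<open>D\<alpha> = - \<alpha> D(1 + sx) \<alpha>\<close> and \<open>D\<beta> = - \<beta> D(1 + xs) \<beta>\<close>.
\<close>

fun diff_gen :: "gen \<Rightarrow> 'r::comm_ring_1 trm" where
  "diff_gen X = Mul (Const (- 1)) (Mul (Gen X) (Gen X))"
| "diff_gen S = Gen Tau"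
| "diff_gen Tau = Const 0"
| "diff_gen Alpha = Mul (Const (- 1)) (Mul (Gen Alpha) (Mul
     (Add (Mul (Gen Tau) (Gen X)) (Mul (Gen S) (Mul (Gen X) (Gen X)))) (Gen Alpha)))"
| "diff_gen Beta = Mul (Gen Beta) (Mul
     (Add (Mul (Gen X) (Mul (Gen X) (Gen S))) (Mul (Gen X) (Gen Tau))) (Gen Beta))"

primrec diff_trm :: "'r::comm_ring_1 trm \<Rightarrow> 'r trm" where
  "diff_trm (Const r) = Const 0"
| "diff_trm (Gen g) = diff_gen g"
| "diff_trm (Add a b) = Add (diff_trm a) (diff_trm b)"
| "diff_trm (Mul a b) = Add (Mul (diff_trm a) b) (Mul (sign_trm a) (diff_trm b))"

text \<open>
  \<open>\<H>\<close> is a differential graded algebra, so it is the quotient of the free one by the differential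
  ideal generated by \<open>s\<^sup>2\<close>, that is, the ideal generated by \<open>s\<^sup>2\<close> and \<open>D(s\<^sup>2) = \<tau>s - s\<tau>\<close>.
  \<open>\<P>\<close> is free on \<open>x\<close> as an algebra (\<open>Dx = - x\<^sup>2\<close> only prescribes the differential).
  The coproduct \<open>\<P> * \<H>\<close> is therefore presented by \<open>x, s, \<tau>\<close> and \<open>pseudocontraction_rels\<close>,
  and its localization by adjoining \<open>\<alpha>, \<beta>\<close> and \<open>inverse_rels\<close>.
\<close>

definition pseudocontraction_rels :: "('r::comm_ring_1 trm \<times> 'r trm) set" where
  "pseudocontraction_rels =
    {(Mul (Gen S) (Gen S), Const 0), (diff_trm (Mul (Gen S) (Gen S)), Const 0)}"

definition inverse_rels :: "('r::comm_ring_1 trm \<times> 'r trm) set" where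
  "inverse_rels =
    {(Mul (Gen Alpha) (Add (Const 1) (Mul (Gen S) (Gen X))), Const 1),
     (Mul (Add (Const 1) (Mul (Gen S) (Gen X))) (Gen Alpha), Const 1),
     (Mul (Gen Beta) (Add (Const 1) (Mul (Gen X) (Gen S))), Const 1),
     (Mul (Add (Const 1) (Mul (Gen X) (Gen S))) (Gen Beta), Const 1)}"

abbreviation mc_cong :: "'r::comm_ring_1 trm \<Rightarrow> 'r trm \<Rightarrow> bool" where
  "mc_cong \<equiv> alg_cong (pseudocontraction_rels \<union> inverse_rels)"

quotient_type (overloaded) 'r mc_alg = "'r::comm_ring_1 trm" / mc_cong
  by (rule equivpI)
    (auto intro!: reflpI sympI transpI intro: alg_cong.refl alg_cong.sym alg_cong.trans)

instantiation mc_alg :: (comm_ring_1) ring_1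
begin

lift_definition zero_mc_alg :: "'a mc_alg" is "Const 0" .
lift_definition one_mc_alg :: "'a mc_alg" is "Const 1" .
lift_definition plus_mc_alg :: "'a mc_alg \<Rightarrow> 'a mc_alg \<Rightarrow> 'a mc_alg" is Add
  by (rule alg_cong.add_cong)
lift_definition times_mc_alg :: "'a mc_alg \<Rightarrow> 'a mc_alg \<Rightarrow> 'a mc_alg" is Mul
  by (rule alg_cong.mul_cong)
lift_definition uminus_mc_alg :: "'a mc_alg \<Rightarrow> 'a mc_alg" is "Mul (Const (- 1))"
  by (intro alg_cong.mul_cong alg_cong.refl)
definition minus_mc_alg :: "'a mc_alg \<Rightarrow> 'a mc_alg \<Rightarrow> 'a mc_alg" where
  "minus_mc_alg a b = a + - b"

instance
proof
  fix a b c :: "'a mc_alg"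
  show "a + b + c = a + (b + c)" by transfer (rule alg_cong.add_assoc)
  show "a + b = b + a" by transfer (rule alg_cong.add_comm)
  show "0 + a = a" by transfer (rule alg_cong.add_zero)
  show "- a + a = 0" by transfer (rule alg_cong.add_neg)
  show "a - b = a + - b" by (rule minus_mc_alg_def)
  show "a * b * c = a * (b * c)" by transfer (rule alg_cong.mul_assoc)
  show "1 * a = a" by transfer (rule alg_cong.one_mul)
  show "a * 1 = a" by transfer (rule alg_cong.mul_one)
  show "(a + b) * c = a * c + b * c" by transfer (rule alg_cong.distr_right)
  show "a * (b + c) = a * b + a * c" by transfer (rule alg_cong.distr_left)
  show "(0 :: 'a mc_alg) \<noteq> 1"
  proof transfer
    let ?f = "\<lambda>g. if g = Alpha \<or> g = Beta then 1 else 0 :: 'a"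
    show "\<not> mc_cong (Const (0 :: 'a)) (Const 1)"
    proof
      assume "mc_cong (Const (0 :: 'a)) (Const 1)"
      then have "eval (\<lambda>r. r) ?f (Const (0 :: 'a)) = eval (\<lambda>r. r) ?f (Const 1)"
        by (rule eval_cong[rotated -1])
          (auto simp: pseudocontraction_rels_def inverse_rels_def mult.commute)
      then show False by simp
    qed
  qed
qed

end

lift_definition scalar :: "'r::comm_ring_1 \<Rightarrow> 'r mc_alg" is Const .
lift_definition gen :: "gen \<Rightarrow> 'r::comm_ring_1 mc_alg" is Gen .

abbreviation x_hat :: "'r::comm_ring_1 mc_alg" where "x_hat \<equiv> gen X"
abbreviation s_hat :: "'r::comm_ring_1 mc_alg" where "s_hat \<equiv> gen S"
abbreviation tau_hat :: "'r::comm_ring_1 mc_alg" where "tau_hat \<equiv> gen Tau"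
abbreviation alpha_hat :: "'r::comm_ring_1 mc_alg" where "alpha_hat \<equiv> gen Alpha"
abbreviation beta_hat :: "'r::comm_ring_1 mc_alg" where "beta_hat \<equiv> gen Beta"

definition t_hat :: "'r::comm_ring_1 mc_alg" where "t_hat = 1 - tau_hat"

text \<open>\<open>scalar r * a\<close> is the \<open>'r\<close>-module action.\<close>

lemma scalar_add: "scalar (p + q) = scalar p + scalar q"
  by transfer (rule alg_cong.const_add)

lemma scalar_mult: "scalar (p * q) = scalar p * scalar q"
  by transfer (rule alg_cong.const_mul)

lemma scalar_one: "scalar 1 = 1"
  by transfer (rule alg_cong.refl)

lemma scalar_zero: "scalar 0 = 0"
  by transfer (rule alg_cong.refl)

lemma scalar_minus_one: "scalar (- 1) = - 1"
  using scalar_add[of "-1" 1] by (simp add: scalar_one scalar_zero eq_neg_iff_add_eq_0)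

lemma scalar_central: "scalar p * a = a * scalar p"
  by transfer (rule alg_cong.const_central)

lemma abs_mc_alg_eval: "abs_mc_alg a = eval scalar gen a"
  by (induction a)
    (simp_all add: scalar.abs_eq gen.abs_eq plus_mc_alg.abs_eq[symmetric] times_mc_alg.abs_eq[symmetric])

lemma s_square: "s_hat * s_hat = (0 :: 'r::comm_ring_1 mc_alg)"
  by transfer (simp add: alg_cong.rel pseudocontraction_rels_def)

lemma alpha_inverse:
  "alpha_hat * (1 + s_hat * x_hat) = (1 :: 'r::comm_ring_1 mc_alg)"
  "(1 + s_hat * x_hat) * alpha_hat = (1 :: 'r::comm_ring_1 mc_alg)"
  by (transfer, simp add: alg_cong.rel inverse_rels_def)+

lemma beta_inverse:
  "beta_hat * (1 + x_hat * s_hat) = (1 :: 'r::comm_ring_1 mc_alg)"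
  "(1 + x_hat * s_hat) * beta_hat = (1 :: 'r::comm_ring_1 mc_alg)"
  by (transfer, simp add: alg_cong.rel inverse_rels_def)+

lemma tau_s_commute: "tau_hat * s_hat = s_hat * (tau_hat :: 'r::comm_ring_1 mc_alg)"
proof -
  have "abs_mc_alg (diff_trm (Mul (Gen S) (Gen S))) = (abs_mc_alg (Const 0) :: 'r mc_alg)"
    unfolding mc_alg.abs_eq_iff by (simp add: alg_cong.rel pseudocontraction_rels_def)
  then show ?thesis
    by (simp add: abs_mc_alg_eval scalar_zero scalar_minus_one)
qed

lemma mc_alg_induct [case_names scalar gen add mult]:
  assumes "\<And>r. P (scalar r)" "\<And>g. P (gen g)"
    and "\<And>a b. P a \<Longrightarrow> P b \<Longrightarrow> P (a + b)" "\<And>a b. P a \<Longrightarrow> P b \<Longrightarrow> P (a * b)"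
  shows "P a"
proof (induction a rule: mc_alg.abs_induct)
  fix y
  have "P (eval scalar gen y)" by (induction y) (auto intro: assms)
  then show "P (abs_mc_alg y)" by (simp add: abs_mc_alg_eval)
qed


section \<open>Grading and differential\<close>

text \<open>\<open>homogeneous n\<close> is the \<open>'r\<close>-span of the monomials of degree \<open>n\<close>.\<close>

inductive homogeneous :: "int \<Rightarrow> 'r::comm_ring_1 mc_alg \<Rightarrow> bool" where
  zero: "homogeneous n 0"
| scalar: "homogeneous 0 (scalar r)"
| gen: "homogeneous (gen_deg g) (gen g)"
| add: "homogeneous n a \<Longrightarrow> homogeneous n b \<Longrightarrow> homogeneous n (a + b)"
| mult: "homogeneous m a \<Longrightarrow> homogeneous n b \<Longrightarrow> homogeneous (m + n) (a * b)"

lemma eval_scalar_cong: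
  assumes "mc_cong a b"
    and "\<And>l r. (l, r) \<in> pseudocontraction_rels \<union> inverse_rels \<Longrightarrow>
      eval scalar f l = eval scalar f r"
  shows "eval scalar f a = (eval scalar f b :: 'r::comm_ring_1 mc_alg)"
  using scalar_add scalar_mult scalar_one scalar_central assms(2,1) by (rule eval_cong)

lemma abs_sign_trm:
  "abs_mc_alg (sign_trm a) = eval scalar (\<lambda>g. if even (gen_deg g) then gen g else - gen g) a"
  by (induction a) (simp_all add: abs_mc_alg_eval scalar_minus_one)

lift_definition sign :: "'r::comm_ring_1 mc_alg \<Rightarrow> 'r mc_alg" is sign_trm
  unfolding mc_alg.abs_eq_iff[symmetric] abs_sign_trm unfolding mc_alg.abs_eq_iff
  by (erule eval_scalar_cong)
    (auto simp: pseudocontraction_rels_def inverse_rels_def scalar_zero scalar_one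
      scalar_minus_one s_square tau_s_commute alpha_inverse beta_inverse)

lemma sign_simps [simp]:
  "sign (scalar r) = scalar r"
  "sign (gen g) = (if even (gen_deg g) then gen g else - gen g)"
  "sign (a + b) = sign a + sign b"
  "sign (a * b) = sign a * sign b"
  by (transfer, simp add: alg_cong.refl)+

lemma sign_homogeneous: "homogeneous n a \<Longrightarrow> sign a = (if even n then a else - a)"
proof (induction rule: homogeneous.induct)
  case (zero n)
  have "sign (scalar 0 :: 'a mc_alg) = scalar 0" by (rule sign_simps)
  then show ?case by (simp add: scalar_zero)
qed auto

lemma sign_zero [simp]: "sign 0 = 0"
  using sign_simps(1)[of 0] by (simp add: scalar_zero)

lemma sign_one [simp]: "sign 1 = 1"
  using sign_simps(1)[of 1] by (simp add: scalar_one)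

lemma sign_uminus [simp]: "sign (- a) = - sign a"
  using sign_simps(3)[of "- a" a] by (simp add: eq_neg_iff_add_eq_0)

lemma sign_diff [simp]: "sign (a - b) = sign a - sign b"
  using sign_simps(3)[of a "- b"] by simp

lemma abs_Const: "abs_mc_alg (Const r) = scalar r"
  and abs_Gen: "abs_mc_alg (Gen g) = gen g"
  and abs_Add: "abs_mc_alg (Add a b) = abs_mc_alg a + abs_mc_alg b"
  and abs_Mul: "abs_mc_alg (Mul a b) = abs_mc_alg a * abs_mc_alg b"
  by (simp_all add: abs_mc_alg_eval)

lemmas abs_simps = abs_Const abs_Gen abs_Add abs_Mul sign.abs_eq[symmetric]
  scalar_zero scalar_one scalar_minus_one

lemma inverse_cancel:
  "(1 + s_hat * x_hat) * (alpha_hat * a) = a"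
  "(1 + x_hat * s_hat) * (beta_hat * a) = a"
  by (simp_all add: alpha_inverse beta_inverse flip: mult.assoc)

lemma diff_trm_cong:
  assumes "mc_cong a b"
  shows "abs_mc_alg (diff_trm a) = (abs_mc_alg (diff_trm b) :: 'r::comm_ring_1 mc_alg)"
  using assms
proof induction
  case (rel a b)
  then show ?case
    by (auto simp: pseudocontraction_rels_def inverse_rels_def abs_simps tau_s_commute mult.assoc
        alpha_inverse beta_inverse inverse_cancel) (simp_all add: algebra_simps)
next
  case (mul_cong a a' b b')
  then have "abs_mc_alg a = abs_mc_alg a'" "abs_mc_alg b = abs_mc_alg b'"
    by (simp_all add: mc_alg.abs_eq_iff)
  with mul_cong show ?case by (simp add: abs_simps)
next
  case (const_central p a)
  show ?case by (simp add: abs_simps scalar_central)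
qed (simp_all add: abs_simps algebra_simps)

lift_definition hat_D :: "'r::comm_ring_1 mc_alg \<Rightarrow> 'r mc_alg" is diff_trm
  using diff_trm_cong by (simp add: mc_alg.abs_eq_iff)

lemma hat_D_scalar: "hat_D (scalar r) = 0"
  by transfer (simp add: alg_cong.refl)

lemma hat_D_add: "hat_D (a + b) = hat_D a + hat_D b"
  by transfer (simp add: alg_cong.refl)

lemma hat_D_zero: "hat_D 0 = 0"
  using hat_D_scalar[of 0] by (simp add: scalar_zero)

lemma hat_D_mult: "hat_D (a * b) = hat_D a * b + sign a * hat_D b"
  by transfer (simp add: alg_cong.refl)

lemma hat_D_mult_homogeneous:
  "homogeneous n a \<Longrightarrow> hat_D (a * b) = hat_D a * b + (if even n then 1 else - 1) * a * hat_D b"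
  by (simp add: hat_D_mult sign_homogeneous)

lemma hat_D_gen: "hat_D (gen g) = abs_mc_alg (diff_gen g)"
  by (simp add: gen.abs_eq hat_D.abs_eq)

lemma hat_D_x: "hat_D x_hat + x_hat * x_hat = 0"
  and hat_D_s: "hat_D s_hat = tau_hat"
  and hat_D_tau: "hat_D tau_hat = 0"
  by (simp_all add: hat_D_gen abs_simps)

lemma hat_D_gens:
  "hat_D x_hat = - (x_hat * x_hat)"
  "hat_D s_hat = tau_hat"
  "hat_D tau_hat = 0"
  "hat_D alpha_hat = - (alpha_hat * ((tau_hat * x_hat + s_hat * (x_hat * x_hat)) * alpha_hat))"
  "hat_D beta_hat = beta_hat * ((x_hat * (x_hat * s_hat) + x_hat * tau_hat) * beta_hat)"
  by (simp_all add: hat_D_gen abs_simps)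

lemma hat_D_uminus: "hat_D (- a) = - hat_D a"
proof -
  have "hat_D (- a) = hat_D (scalar (- 1) * a)" by (simp add: scalar_minus_one)
  also have "\<dots> = - hat_D a" unfolding hat_D_mult hat_D_scalar by (simp add: scalar_minus_one)
  finally show ?thesis .
qed

lemma hat_D_diff: "hat_D (a - b) = hat_D a - hat_D b"
  using hat_D_add[of a "- b"] by (simp add: hat_D_uminus)

lemma sign_hat_D: "hat_D (sign a) = - sign (hat_D a)"
proof (induction a rule: mc_alg_induct)
  case (gen g)
  show ?case by (cases g) (simp_all add: hat_D_gens hat_D_uminus algebra_simps)
qed (simp_all add: hat_D_scalar hat_D_add hat_D_mult algebra_simps)

lemma sign_sign: "sign (sign a) = a"
  by (induction a rule: mc_alg_induct) simp_all

lemma hat_D_square: "hat_D (hat_D a) = 0"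
proof (induction a rule: mc_alg_induct)
  case (scalar r)
  show ?case by (simp add: hat_D_scalar hat_D_zero)
next
  case (gen g)
  show ?case
    by (cases g)
      (simp_all add: hat_D_zero hat_D_gens hat_D_add hat_D_mult hat_D_uminus hat_D_diff
        algebra_simps)
next
  case (mult a b)
  then show ?case by (simp add: hat_D_add hat_D_mult sign_hat_D sign_sign)
qed (simp add: hat_D_add)

lemma homogeneous_minus: "homogeneous n a \<Longrightarrow> homogeneous n (- a)"
  using homogeneous.mult[OF homogeneous.scalar[of "- 1"], of n a] by (simp add: scalar_minus_one)

lemma homogeneous_mult': "homogeneous m a \<Longrightarrow> homogeneous n b \<Longrightarrow> k = m + n \<Longrightarrow> homogeneous k (a * b)"
  by (simp add: homogeneous.mult)

lemma homogeneous_gens: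
  "homogeneous (- 1) x_hat" "homogeneous 1 s_hat" "homogeneous 0 tau_hat"
  "homogeneous 0 alpha_hat" "homogeneous 0 beta_hat" "homogeneous 0 1"
  using homogeneous.gen[of X] homogeneous.gen[of S] homogeneous.gen[of Tau]
    homogeneous.gen[of Alpha] homogeneous.gen[of Beta] homogeneous.scalar[of 1]
  by (simp_all add: scalar_one)

lemma hat_D_homogeneous: "homogeneous n a \<Longrightarrow> homogeneous (n - 1) (hat_D a)"
proof (induction rule: homogeneous.induct)
  case (zero n)
  show ?case by (simp add: hat_D_zero homogeneous.zero)
next
  case (scalar r)
  show ?case by (simp add: hat_D_scalar homogeneous.zero)
next
  case (gen g)
  show ?case
    by (cases g)
      (simp_all add: hat_D_gens homogeneous.zero homogeneous_gens homogeneous_minus,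
       ((rule homogeneous_minus)?, (rule homogeneous_mult' homogeneous.add homogeneous_gens
        | simp (no_asm))+)+)
next
  case (mult m a n b)
  have "homogeneous m (sign a)"
    using mult.hyps by (simp add: sign_homogeneous homogeneous_minus)
  with mult show ?case
    unfolding hat_D_mult
    by (intro homogeneous.add) (auto intro: homogeneous_mult')
qed (simp add: hat_D_add homogeneous.add)

text \<open>The graded commutator \<open>[a, b]\<close> for \<open>a\<close> of odd degree and arbitrary \<open>b\<close>.\<close>

definition odd_commutator :: "'r::comm_ring_1 mc_alg \<Rightarrow> 'r mc_alg \<Rightarrow> 'r mc_alg" where
  "odd_commutator a b = a * b - sign b * a"

lemma odd_commutator_homogeneous:
  "homogeneous n b \<Longrightarrow> odd_commutator a b = a * b - (if even n then 1 else - 1) * b * a"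
  by (simp add: odd_commutator_def sign_homogeneous)

definition twisted_D :: "'r::comm_ring_1 mc_alg \<Rightarrow> 'r mc_alg" where
  "twisted_D a = hat_D a + odd_commutator x_hat a"

definition graded_algebra_endo :: "('r::comm_ring_1 mc_alg \<Rightarrow> 'r mc_alg) \<Rightarrow> bool" where
  "graded_algebra_endo f \<longleftrightarrow>
    f 1 = 1 \<and> (\<forall>a b. f (a + b) = f a + f b) \<and> (\<forall>a b. f (a * b) = f a * f b) \<and>
    (\<forall>r a. f (scalar r * a) = scalar r * f a) \<and>
    (\<forall>n a. homogeneous n a \<longrightarrow> homogeneous n (f a))"

definition is_pmc_involution :: "('r::comm_ring_1 mc_alg \<Rightarrow> 'r mc_alg) \<Rightarrow> bool" where
  "is_pmc_involution f \<longleftrightarrow>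
    graded_algebra_endo f \<and> f \<circ> f = id \<and> f x_hat = - x_hat \<and>
    f s_hat = alpha_hat * s_hat \<and> f s_hat = s_hat * beta_hat \<and>
    f t_hat = alpha_hat * t_hat * beta_hat"

text \<open>
  The remainder shows that the conditions above determine exactly one map.
\<close>

fun inv_gen :: "gen \<Rightarrow> 'r::comm_ring_1 mc_alg" where
  "inv_gen X = - x_hat"
| "inv_gen S = alpha_hat * s_hat"
| "inv_gen Tau = 1 - alpha_hat * t_hat * beta_hat"
| "inv_gen Alpha = 1 + s_hat * x_hat"
| "inv_gen Beta = 1 + x_hat * s_hat"

lemma alpha_s: "alpha_hat * s_hat = s_hat * (beta_hat :: 'r::comm_ring_1 mc_alg)"
proof -
  have "alpha_hat * s_hat
      = alpha_hat * (s_hat * (1 + x_hat * s_hat)) * (beta_hat :: 'r mc_alg)"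
    by (simp add: mult.assoc beta_inverse)
  also have "s_hat * (1 + x_hat * s_hat) = (1 + s_hat * x_hat) * (s_hat :: 'r mc_alg)"
    by (simp add: algebra_simps)
  also have "alpha_hat * ((1 + s_hat * x_hat) * s_hat) * beta_hat = s_hat * (beta_hat :: 'r mc_alg)"
    by (simp add: alpha_inverse flip: mult.assoc)
  finally show ?thesis .
qed

lemma s_alpha: "s_hat * alpha_hat = (s_hat :: 'r::comm_ring_1 mc_alg)"
proof -
  have "s_hat * (1 + s_hat * x_hat) = (s_hat :: 'r mc_alg)"
    by (simp add: distrib_left s_square flip: mult.assoc)
  then have "s_hat * alpha_hat = s_hat * (1 + s_hat * x_hat) * (alpha_hat :: 'r mc_alg)"
    by simp
  also have "\<dots> = s_hat" by (simp add: mult.assoc alpha_inverse)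
  finally show ?thesis .
qed

lemma beta_s: "beta_hat * s_hat = (s_hat :: 'r::comm_ring_1 mc_alg)"
proof -
  have "(1 + x_hat * s_hat) * s_hat = (s_hat :: 'r mc_alg)"
    by (simp add: distrib_right s_square mult.assoc)
  then have "beta_hat * s_hat = beta_hat * ((1 + x_hat * s_hat) * (s_hat :: 'r mc_alg))"
    by simp
  also have "\<dots> = s_hat" by (simp add: beta_inverse flip: mult.assoc)
  finally show ?thesis .
qed

lemma t_s: "t_hat * s_hat = s_hat * t_hat"
  by (simp add: t_hat_def algebra_simps tau_s_commute)

lemma alpha_sx: "alpha_hat * (s_hat * x_hat) = 1 - alpha_hat"
  using alpha_inverse(1) by (simp add: algebra_simps eq_diff_eq)

lemma xs_beta: "x_hat * (s_hat * beta_hat) = 1 - beta_hat"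
  using beta_inverse(2) by (simp add: algebra_simps eq_diff_eq)

lemma cancel_left:
  "s_hat * (alpha_hat * a) = s_hat * a"
  "beta_hat * (s_hat * a) = s_hat * a"
  "t_hat * (s_hat * a) = s_hat * (t_hat * a)"
  "s_hat * (s_hat * a) = 0"
  by (simp_all add: s_alpha beta_s t_s s_square flip: mult.assoc)

lemma involution_t_s:
  "alpha_hat * t_hat * beta_hat * (alpha_hat * s_hat)
    = alpha_hat * s_hat * (alpha_hat * t_hat * (beta_hat :: 'r::comm_ring_1 mc_alg))"
proof -
  have "alpha_hat * t_hat * beta_hat * (alpha_hat * s_hat)
      = alpha_hat * (s_hat * (t_hat * (beta_hat :: 'r mc_alg)))"
    unfolding alpha_s by (simp add: mult.assoc cancel_left)
  also have "\<dots> = alpha_hat * s_hat * (alpha_hat * t_hat * beta_hat)"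
    by (simp add: mult.assoc cancel_left)
  finally show ?thesis .
qed

lemma eval_inv_gen_cong:
  assumes "mc_cong a b"
  shows "eval scalar inv_gen a = (eval scalar inv_gen b :: 'r::comm_ring_1 mc_alg)"
  using assms
proof (rule eval_scalar_cong)
  fix l r :: "'r trm"
  assume "(l, r) \<in> pseudocontraction_rels \<union> inverse_rels"
  moreover have "alpha_hat * s_hat * (alpha_hat * s_hat) = (0 :: 'r mc_alg)"
    by (simp add: mult.assoc cancel_left s_square)
  moreover have "(1 - alpha_hat * t_hat * beta_hat) * (alpha_hat * s_hat)
      = alpha_hat * s_hat * (1 - alpha_hat * t_hat * (beta_hat :: 'r mc_alg))"
    by (simp add: left_diff_distrib right_diff_distrib involution_t_s)
  moreover have "1 - alpha_hat * s_hat * x_hat = (alpha_hat :: 'r mc_alg)"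
    by (simp add: mult.assoc alpha_sx)
  moreover have "1 - x_hat * (alpha_hat * s_hat) = (beta_hat :: 'r mc_alg)"
    unfolding alpha_s by (simp add: xs_beta)
  ultimately show "eval scalar inv_gen l = (eval scalar inv_gen r :: 'r mc_alg)"
    by (auto simp: pseudocontraction_rels_def inverse_rels_def scalar_zero scalar_one
        scalar_minus_one alpha_inverse beta_inverse)
qed

definition pmc_involution :: "'r::comm_ring_1 mc_alg \<Rightarrow> 'r mc_alg" where
  "pmc_involution a = eval scalar inv_gen (rep_mc_alg a)"

lemma pmc_involution_abs: "pmc_involution (abs_mc_alg a) = eval scalar inv_gen a"
  unfolding pmc_involution_def
  by (rule eval_inv_gen_cong) (simp add: Quotient3_rep_abs[OF Quotient3_mc_alg] alg_cong.refl)

lemma pmc_involution_scalar: "pmc_involution (scalar r) = scalar r"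
  and pmc_involution_gen: "pmc_involution (gen g) = inv_gen g"
  using pmc_involution_abs[of "Const r"] pmc_involution_abs[of "Gen g"]
  by (simp_all add: abs_simps)

lemma pmc_involution_add: "pmc_involution (a + b) = pmc_involution a + pmc_involution b"
  by (induction a rule: mc_alg.abs_induct, induction b rule: mc_alg.abs_induct)
    (simp add: pmc_involution_abs flip: abs_Add)

lemma pmc_involution_mult: "pmc_involution (a * b) = pmc_involution a * pmc_involution b"
  by (induction a rule: mc_alg.abs_induct, induction b rule: mc_alg.abs_induct)
    (simp add: pmc_involution_abs flip: abs_Mul)

lemma pmc_involution_one: "pmc_involution 1 = 1"
  using pmc_involution_scalar[of 1] by (simp add: scalar_one)

lemma pmc_involution_zero: "pmc_involution 0 = 0"
  using pmc_involution_scalar[of 0] by (simp add: scalar_zero)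

lemma pmc_involution_uminus: "pmc_involution (- a) = - pmc_involution a"
  using pmc_involution_mult[of "scalar (- 1)" a] unfolding pmc_involution_scalar
  by (simp add: scalar_minus_one)

lemma pmc_involution_diff: "pmc_involution (a - b) = pmc_involution a - pmc_involution b"
  using pmc_involution_add[of a "- b"] by (simp add: pmc_involution_uminus)

lemma pmc_involution_t: "pmc_involution t_hat = alpha_hat * t_hat * beta_hat"
  by (simp add: t_hat_def[where 'r = 'a] pmc_involution_diff pmc_involution_one pmc_involution_gen)

lemma pmc_involution_invol: "pmc_involution (pmc_involution a) = a"
proof (induction a rule: mc_alg_induct)
  case (gen g)
  have "(1 + s_hat * x_hat) * (alpha_hat * t_hat * beta_hat) * (1 + x_hat * s_hat)
      = (t_hat :: 'a mc_alg)"
    by (simp add: mult.assoc inverse_cancel beta_inverse)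
  moreover have "1 - alpha_hat * s_hat * x_hat = (alpha_hat :: 'a mc_alg)"
    by (simp add: mult.assoc alpha_sx)
  moreover have "1 - x_hat * (alpha_hat * s_hat) = (beta_hat :: 'a mc_alg)"
    unfolding alpha_s by (simp add: xs_beta)
  ultimately show ?case
    by (cases g)
      (simp_all add: pmc_involution_gen pmc_involution_uminus pmc_involution_mult
        pmc_involution_add pmc_involution_diff pmc_involution_one pmc_involution_t
        inverse_cancel, simp add: t_hat_def)
qed (simp_all add: pmc_involution_scalar pmc_involution_add pmc_involution_mult)

lemma homogeneous_diff: "homogeneous n a \<Longrightarrow> homogeneous n b \<Longrightarrow> homogeneous n (a - b)"
  using homogeneous.add[of n a "- b"] by (simp add: homogeneous_minus)

lemma pmc_involution_homogeneous: "homogeneous n a \<Longrightarrow> homogeneous n (pmc_involution a)"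
proof (induction rule: homogeneous.induct)
  case (zero n)
  show ?case by (simp add: pmc_involution_zero homogeneous.zero)
next
  case (gen g)
  have "homogeneous 0 (t_hat :: 'a mc_alg)"
    unfolding t_hat_def by (intro homogeneous_diff homogeneous_gens)
  then show ?case
    by (cases g)
      (auto simp: pmc_involution_gen intro!: homogeneous_minus homogeneous_diff homogeneous.add
        homogeneous_gens intro: homogeneous_mult' homogeneous_gens)
qed (auto simp: pmc_involution_scalar pmc_involution_add pmc_involution_mult
    intro: homogeneous.intros)

lemma is_pmc_involution_pmc_involution: "is_pmc_involution pmc_involution"
  unfolding is_pmc_involution_def graded_algebra_endo_def
  by (auto simp: pmc_involution_one pmc_involution_add pmc_involution_mult pmc_involution_scalar
      pmc_involution_homogeneous pmc_involution_gen pmc_involution_t pmc_involution_invol alpha_s)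

lemma is_pmc_involution_unique:
  assumes "is_pmc_involution f"
  shows "f = pmc_involution"
proof
  have one: "f 1 = 1" and add: "\<And>a b. f (a + b) = f a + f b"
    and mult: "\<And>a b. f (a * b) = f a * f b"
    and lin: "\<And>r a. f (scalar r * a) = scalar r * f a"
    and x: "f x_hat = - x_hat" and s: "f s_hat = alpha_hat * s_hat"
    and t: "f t_hat = alpha_hat * t_hat * beta_hat"
    using assms by (auto simp: is_pmc_involution_def graded_algebra_endo_def)
  have inv_eq: "b = c" if "a * b = 1" "c * a = 1" for a b c :: "'a mc_alg"
  proof -
    have "b = c * a * b" using that(2) by simp
    also have "\<dots> = c * (a * b)" by (rule mult.assoc)
    finally show ?thesis using that(1) by simp
  qed
  have tau: "f tau_hat = 1 - alpha_hat * t_hat * beta_hat"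
    using add[of tau_hat t_hat] one t by (simp add: t_hat_def eq_diff_eq)
  have "f (1 + s_hat * x_hat) = alpha_hat"
    by (simp add: one add mult s x mult.assoc alpha_sx)
  then have alpha: "f alpha_hat = 1 + s_hat * x_hat"
    using inv_eq[of alpha_hat "f alpha_hat" "1 + s_hat * x_hat"]
      mult[of "1 + s_hat * x_hat" alpha_hat] by (simp add: alpha_inverse one)
  have "f (1 + x_hat * s_hat) = beta_hat"
    unfolding one add mult s x alpha_s by (simp add: xs_beta)
  then have beta: "f beta_hat = 1 + x_hat * s_hat"
    using inv_eq[of beta_hat "f beta_hat" "1 + x_hat * s_hat"]
      mult[of "1 + x_hat * s_hat" beta_hat] by (simp add: beta_inverse one)
  fix a show "f a = pmc_involution a"
  proof (induction a rule: mc_alg_induct)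
    case (scalar r)
    show ?case using lin[of r 1] by (simp add: one pmc_involution_scalar)
  next
    case (gen g)
    show ?case by (cases g) (simp_all add: pmc_involution_gen x s tau alpha beta)
  qed (simp_all add: add mult pmc_involution_add pmc_involution_mult)
qed

theorem ex1_pmc_involution: "\<exists>!f. is_pmc_involution f"
  using is_pmc_involution_pmc_involution is_pmc_involution_unique by blast

end

theory Submission
  imports Defs
begin

text \<open>
  Both \<open>D\<^sup>\<phi>\<close> and \<open>D\<^sup>x\<close> are \<open>R\<close>-linear graded derivations. Such a derivation is determined by
  its values on \<open>x\<close>, \<open>s\<close> and \<open>\<tau>\<close>, since its values on the inverses \<open>\<alpha>\<close> and \<open>\<beta>\<close> are forced.
  The values on \<open>x\<close> and \<open>s\<close> are computed: \<open>D(s\<beta>) = \<beta> - \<alpha>t\<beta> - 1 + \<alpha>\<close>, whose image under \<open>\<phi>\<close>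
  is \<open>\<tau> + xs + sx\<close>. Then \<open>\<tau> = D\<^sup>\<phi> s - xs - sx\<close> and \<open>D\<^sup>\<phi> D\<^sup>\<phi> = 0\<close> give the value on \<open>\<tau>\<close>.
\<close>

text \<open>\<open>sign a\<close> is (-1)^n a in degree n, so the rule covers inhomogeneous
  \<open>a\<close> as well; R-linearity follows from it and the vanishing on scalars.\<close>

definition graded_derivation :: "('r::comm_ring_1 mc_alg \<Rightarrow> 'r mc_alg) \<Rightarrow> bool" where
  "graded_derivation d \<longleftrightarrow>
    (\<forall>r. d (scalar r) = 0) \<and> (\<forall>a b. d (a + b) = d a + d b) \<and>
    (\<forall>a b. d (a * b) = d a * b + sign a * d b)"

text \<open>Apply \<open>d\<close> to \<open>u * v = 1\<close>, where no sign appears since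
  \<open>sign u = u\<close>, and cancel \<open>u\<close> on the left.\<close>

lemma graded_derivation_inverse:
  assumes "graded_derivation d" and "sign u = u" and "v * u = 1" and "u * v = 1"
  shows "d v = - (v * (d u * v))"
proof -
  have "d 1 = 0"
    using assms(1) scalar_one unfolding graded_derivation_def by metis
  then have "d u * v + u * d v = 0"
    using assms unfolding graded_derivation_def by metis
  then have "v * (d u * v) + v * (u * d v) = 0"
    by (simp flip: distrib_left)
  moreover have "v * (u * d v) = d v"
    by (simp add: assms(3) flip: mult.assoc)
  ultimately show ?thesis by (simp add: eq_neg_iff_add_eq_0 add.commute)
qed

lemma graded_derivation_eqI:
  assumes d: "graded_derivation d" and e: "graded_derivation e"
    and x: "d x_hat = e x_hat" and s: "d s_hat = e s_hat" and tau: "d tau_hat = e tau_hat"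
  shows "d = e"
proof
  fix a
  have one: "d 1 = 0" "e 1 = 0"
    using d e scalar_one unfolding graded_derivation_def by metis+
  have sx: "d (1 + s_hat * x_hat) = e (1 + s_hat * x_hat)"
    and xs: "d (1 + x_hat * s_hat) = e (1 + x_hat * s_hat)"
    using d e x s one by (simp_all add: graded_derivation_def)
  show "d a = e a"
  proof (induction a rule: mc_alg_induct)
    case (gen g)
    have "d alpha_hat = e alpha_hat"
      using graded_derivation_inverse[OF d _ alpha_inverse]
        graded_derivation_inverse[OF e _ alpha_inverse] sx by simp
    moreover have "d beta_hat = e beta_hat"
      using graded_derivation_inverse[OF d _ beta_inverse]
        graded_derivation_inverse[OF e _ beta_inverse] xs by simp
    ultimately show ?case using x s tau by (cases g) simp_all
  qed (use d e in \<open>simp_all add: graded_derivation_def\<close>)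
qed

text \<open>The commutator with x obeys the rule because the two terms
  \<open>sign a * x_hat * b\<close> cancel.\<close>

lemma graded_derivation_twisted_D: "graded_derivation twisted_D"
  unfolding graded_derivation_def twisted_D_def odd_commutator_def
  by (auto simp: hat_D_scalar hat_D_add hat_D_mult scalar_central algebra_simps)

lemma sign_pmc_involution: "sign (pmc_involution a) = pmc_involution (sign a)"
proof (induction a rule: mc_alg_induct)
  case (gen g)
  show ?case
    by (cases g)
      (simp_all add: pmc_involution_gen pmc_involution_uminus t_hat_def)
qed (simp_all add: pmc_involution_scalar pmc_involution_add pmc_involution_mult)

text \<open>The sign factor survives conjugation: \<phi> commutes with \<open>sign\<close> and
  squares to the identity.\<close>

lemma graded_derivation_conjugate:
  "graded_derivation (\<lambda>a. pmc_involution (hat_D (pmc_involution a)))"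
  unfolding graded_derivation_def
  by (simp add: pmc_involution_scalar pmc_involution_add pmc_involution_mult hat_D_scalar
      hat_D_add hat_D_mult pmc_involution_zero sign_pmc_involution pmc_involution_invol)

lemma hat_D_s_beta:
  "hat_D (s_hat * beta_hat)
    = beta_hat - alpha_hat * t_hat * beta_hat - 1 + (alpha_hat :: 'r::comm_ring_1 mc_alg)"
proof -
  have sbx: "s_hat * (beta_hat * (x_hat * a)) = a - alpha_hat * a" for a :: "'r mc_alg"
  proof -
    have "s_hat * (beta_hat * (x_hat * a)) = (alpha_hat * (s_hat * x_hat)) * a"
      using alpha_s by (metis mult.assoc)
    then show ?thesis by (simp add: alpha_sx left_diff_distrib)
  qed
  have "hat_D (s_hat * beta_hat) = tau_hat * beta_hat
      - s_hat * (beta_hat * (x_hat * (x_hat * (s_hat * beta_hat) + tau_hat * (beta_hat :: 'r mc_alg))))"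
    by (simp add: hat_D_mult hat_D_gens algebra_simps)
  \<comment> \<open>The subtracted term is (1 - \<alpha>)(1 - t\<beta>), by s\<beta>x = \<alpha>sx =
    1 - \<alpha> and xs\<beta> = 1 - \<beta>.\<close>
  also have "\<dots> = beta_hat - alpha_hat * t_hat * beta_hat - 1 + alpha_hat"
    unfolding sbx xs_beta by (simp add: t_hat_def algebra_simps)
  finally show ?thesis .
qed

text \<open>\<phi> swaps \<alpha> with 1 + sx, \<beta> with 1 + xs, and \<alpha>t\<beta> with
  t.\<close>

lemma conjugate_D_s:
  "pmc_involution (hat_D (pmc_involution s_hat)) = tau_hat + x_hat * s_hat + s_hat * x_hat"
proof -
  have "pmc_involution (alpha_hat * t_hat * beta_hat) = (t_hat :: 'a mc_alg)"
    using pmc_involution_invol[of t_hat] by (simp add: pmc_involution_t)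
  then show ?thesis
    by (simp add: pmc_involution_gen alpha_s hat_D_s_beta pmc_involution_add pmc_involution_diff
        pmc_involution_one) (simp add: t_hat_def)
qed

lemma conjugate_D_eq_twisted_D:
  "(\<lambda>a. pmc_involution (hat_D (pmc_involution a))) = (twisted_D :: 'r::comm_ring_1 mc_alg \<Rightarrow> _)"
    (is "?d = _")
proof (rule graded_derivation_eqI)
  have x: "?d x_hat = x_hat * x_hat"
    by (simp add: pmc_involution_gen hat_D_uminus hat_D_gens pmc_involution_mult)
  \<comment> \<open>As x is odd, [x, x] = 2x^2, and adding Dx = -x^2 leaves x^2.\<close>
  then show "?d x_hat = twisted_D x_hat"
    by (simp add: twisted_D_def odd_commutator_def hat_D_gens)
  show "?d s_hat = twisted_D s_hat"
    by (simp add: conjugate_D_s twisted_D_def odd_commutator_def hat_D_gens)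
  have add: "?d (a + b) = ?d a + ?d b" and mult: "?d (a * b) = ?d a * b + sign a * ?d b" for a b :: "'r mc_alg"
    using graded_derivation_conjugate[where 'a = 'r] by (simp_all add: graded_derivation_def)
  \<comment> \<open>The argument is \<open>?d s_hat\<close>; the inner \<phi>\<phi> cancels and D D
    = 0 remains.\<close>
  have "?d (tau_hat + x_hat * s_hat + s_hat * x_hat) = 0"
    unfolding conjugate_D_s[symmetric]
    by (simp add: pmc_involution_invol hat_D_square pmc_involution_zero)
  then have "?d tau_hat + x_hat * x_hat * s_hat - x_hat * (tau_hat + x_hat * s_hat + s_hat * x_hat)
      + (tau_hat + x_hat * s_hat + s_hat * x_hat) * x_hat - s_hat * (x_hat * x_hat) = 0"
    unfolding add mult x conjugate_D_s by (simp add: algebra_simps)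
  \<comment> \<open>All words of length three cancel, leaving x\<tau> - \<tau>x as the value on
    \<tau>.\<close>
  then show "?d tau_hat = twisted_D tau_hat"
    by (simp add: twisted_D_def odd_commutator_def hat_D_gens algebra_simps)
qed (rule graded_derivation_conjugate graded_derivation_twisted_D)+

theorem theorem4p3:
  fixes \<phi> :: "'r::comm_ring_1 mc_alg \<Rightarrow> 'r mc_alg"
  assumes "graded_algebra_endo \<phi>"
    and "\<phi> \<circ> \<phi> = id"
    and "\<phi> x_hat = - x_hat"
    and "\<phi> s_hat = alpha_hat * s_hat"
    and "\<phi> s_hat = s_hat * beta_hat"
    and "\<phi> t_hat = alpha_hat * t_hat * beta_hat"
  shows "\<phi> \<circ> hat_D \<circ> \<phi> = twisted_D"
proof -
  have "\<phi> = pmc_involution"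
    using assms by (intro is_pmc_involution_unique) (simp add: is_pmc_involution_def)
  then show ?thesis
    by (simp add: comp_def conjugate_D_eq_twisted_D)
qed

end
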